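(* Let $f:[0,\infty[\to\mathbb{R}^d$ be a càdlàg function. Then $f$ is Markov-expandable, i.e. there exists a deterministic Markov process $(X^x)_{x\in\mathbb{R}^d}$ with $X_t^{f(0)}=f(t)$ for every $t\ge 0$, if and only if $f$ is injective or finally constant or jump-periodic.
   Context: A deterministic (time homogeneous, universal) Markov process on $\mathbb{R}^d$ is a family $(X^x)_{x\in\mathbb{R}^d}$ of functions (paths) $t\mapsto X_t^x$, $[0,\infty[\to\mathbb{R}^d$, not depending on $\omega$, with $X_0^x=x$ for every $x$, such that: whenever $X_s^x=X_t^y$ for some $s,t\ge 0$ and $x,y\in\mathbb{R}^d$, then $X_{s+h}^x=X_{t+h}^y$ for every $h\ge 0$. All paths are assumed to be càdlàg (right-continuous with left limits). For a function $f:[0,\infty[\to\mathbb{R}^d$ define (with $\inf\emptyset=\infty$) $$t_1:=\inf\{t\ge 0:\text{there exists } s<t \text{ with } s\geq 0,\ f(s)=f(t)\},$$ $$t_0:=\inf\{s\ge 0:\text{there exists } t>s \text{ with } f(s)=f(t)\}.$$ $f$ is called jump-periodic if $t_0<t_1$ and $f(u)=f(u-(t_1-t_0))$ for every $u\ge t_1$. $f$ is called finally constant if $t_0=t_1<\infty$ and $f$ is injective on $[0,t_0[$ and constant on $[t_0,\infty[$ (for this $t_0$). *)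

theory Defs
  imports "HOL-Analysis.Analysis"
begin

text \<open>
  A function on the half-line \<open>[0, \<infinity>[\<close> is represented by a total function on \<^typ>\<open>real\<close>
  of which only the values at nonnegative arguments are used.
\<close>

definition cadlag :: "(real \<Rightarrow> 'a::topological_space) \<Rightarrow> bool" where
  "cadlag f \<longleftrightarrow>
     (\<forall>t\<ge>0. (f \<longlongrightarrow> f t) (at_right t)) \<and>
     (\<forall>t>0. \<exists>l. (f \<longlongrightarrow> l) (at_left t))"

definition deterministic_Markov_process ::
    "(real ^ 'd \<Rightarrow> real \<Rightarrow> real ^ 'd) \<Rightarrow> bool" where
  "deterministic_Markov_process X \<longleftrightarrow>
     (\<forall>x. X x 0 = x) \<and>
     (\<forall>x y s t. 0 \<le> s \<longrightarrow> 0 \<le> t \<longrightarrow> X x s = X y t \<longrightarrow>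
        (\<forall>h\<ge>0. X x (s + h) = X y (t + h))) \<and>
     (\<forall>x. cadlag (X x))"

definition Markov_expandable :: "(real \<Rightarrow> real ^ 'd) \<Rightarrow> bool" where
  "Markov_expandable f \<longleftrightarrow>
     (\<exists>X. deterministic_Markov_process X \<and> (\<forall>t\<ge>0. X (f 0) t = f t))"

text \<open>
  The two infima are taken in the extended reals, so that the infimum of the empty set is \<open>\<infinity>\<close>.
\<close>

definition time1 :: "(real \<Rightarrow> 'a) \<Rightarrow> ereal" where
  "time1 f = Inf (ereal ` {t. 0 \<le> t \<and> (\<exists>s. 0 \<le> s \<and> s < t \<and> f s = f t)})"

definition time0 :: "(real \<Rightarrow> 'a) \<Rightarrow> ereal" where
  "time0 f = Inf (ereal ` {s. 0 \<le> s \<and> (\<exists>t. s < t \<and> f s = f t)})"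

text \<open>
  If \<open>time0 f < time1 f\<close> then both are finite, since \<open>time0 f < \<infinity>\<close> yields a repeated value of \<open>f\<close>
  and hence \<open>time1 f < \<infinity>\<close>; so the conversion to \<^typ>\<open>real\<close> below is exact.
\<close>

definition jump_periodic :: "(real \<Rightarrow> 'a) \<Rightarrow> bool" where
  "jump_periodic f \<longleftrightarrow>
     time0 f < time1 f \<and>
     (\<forall>u. time1 f \<le> ereal u \<longrightarrow> f u = f (u - real_of_ereal (time1 f - time0 f)))"

definition finally_constant :: "(real \<Rightarrow> 'a) \<Rightarrow> bool" where
  "finally_constant f \<longleftrightarrow>
     time0 f = time1 f \<and> time1 f < \<infinity> \<and>
     inj_on f {t. 0 \<le> t \<and> ereal t < time0 f} \<and>
     f constant_on {t. time0 f \<le> ereal t}"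

end

theory Submission
  imports Defs
begin

text \<open>
  Markov expandability of \<open>f\<close> means that a repeated value of \<open>f\<close> forces the whole futures to agree:
  the converse direction runs \<open>f\<close> from any point of its range and keeps every other point fixed.
  If such an \<open>f\<close> is not injective, right-continuity shows that the set of times whose value is
  attained again is a closed half-line \<open>[a, \<infinity>[\<close>, and the return times of \<open>a\<close> are closed under
  positive differences. Either they are arbitrarily small, whence \<open>f\<close> is constant on \<open>[a, \<infinity>[\<close>,
  or they have a least element, which is the period.
\<close>

section \<open>Reduction to a condition on \<open>f\<close> alone\<close>

definition future_determined :: "(real \<Rightarrow> 'a) \<Rightarrow> bool" where
  "future_determined f \<longleftrightarrow>
     (\<forall>s t h. 0 \<le> s \<longrightarrow> 0 \<le> t \<longrightarrow> 0 \<le> h \<longrightarrow> f s = f t \<longrightarrow> f (s + h) = f (t + h))"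

lemma future_determinedD:
  assumes "future_determined f" "0 \<le> s" "0 \<le> t" "0 \<le> h" "f s = f t"
  shows "f (s + h) = f (t + h)"
  using assms unfolding future_determined_def by blast

lemma future_determinedI:
  assumes "\<And>s t h. 0 \<le> s \<Longrightarrow> s < t \<Longrightarrow> 0 \<le> h \<Longrightarrow> f s = f t \<Longrightarrow> f (s + h) = f (t + h)"
  shows "future_determined f"
  unfolding future_determined_def by (metis assms linorder_less_linear)

lemma cadlag_shift:
  assumes "cadlag f" "0 \<le> s"
  shows "cadlag (\<lambda>h. f (s + h))"
  unfolding cadlag_def
proof (intro conjI allI impI)
  fix t :: real assume "0 \<le> t"
  then have "(f \<longlongrightarrow> f (s + t)) (at_right (s + t))"
    using assms by (simp add: cadlag_def)
  then show "((\<lambda>h. f (s + h)) \<longlongrightarrow> f (s + t)) (at_right t)"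
    by (simp add: filterlim_at_right_to_0[of f _ "s + t"] filterlim_at_right_to_0[of _ _ t] add_ac)
next
  fix t :: real assume "0 < t"
  then obtain l where "(f \<longlongrightarrow> l) (at_left (s + t))"
    using assms by (force simp: cadlag_def)
  moreover have "filterlim (\<lambda>h. s + h) (at_left (s + t)) (at_left t)"
    by (auto simp: filterlim_at eventually_at_filter intro!: tendsto_eq_intros)
  ultimately have "((\<lambda>h. f (s + h)) \<longlongrightarrow> l) (at_left t)"
    by (rule filterlim_compose)
  then show "\<exists>l. ((\<lambda>h. f (s + h)) \<longlongrightarrow> l) (at_left t)" ..
qed

text \<open>Comparing the path from \<open>f 0\<close> with itself in the Markov property gives one
  direction. Conversely, future determinacy makes the path through a point of the range independent
  of the time at which \<open>f\<close> is entered.\<close>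

lemma Markov_expandable_iff_future_determined:
  fixes f :: "real \<Rightarrow> real ^ 'd"
  assumes "cadlag f"
  shows "Markov_expandable f \<longleftrightarrow> future_determined f"
proof
  assume "Markov_expandable f"
  then obtain X where X: "deterministic_Markov_process X" "\<And>t. 0 \<le> t \<Longrightarrow> X (f 0) t = f t"
    by (auto simp: Markov_expandable_def)
  show "future_determined f"
    unfolding future_determined_def
  proof (intro allI impI)
    fix s t h :: real assume "0 \<le> s" "0 \<le> t" "0 \<le> h" "f s = f t"
    moreover from this have "X (f 0) (s + h) = X (f 0) (t + h)"
      using X unfolding deterministic_Markov_process_def by metis
    ultimately show "f (s + h) = f (t + h)"
      using X(2) by simp
  qed
next
  assume fd: "future_determined f"
  \<comment> \<open>An arbitrary time at which \<open>f\<close> visits \<open>x\<close>; outside the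
    range the value is unspecified, and \<open>X\<close> does not use it there.\<close>
  define \<tau> where "\<tau> x = (SOME s. 0 \<le> s \<and> f s = x)" for x
  have \<tau>: "0 \<le> \<tau> x" "f (\<tau> x) = x" if "x \<in> f ` {0..}" for x
  proof -
    have "\<exists>s. 0 \<le> s \<and> f s = x" using that by auto
    then have "0 \<le> \<tau> x \<and> f (\<tau> x) = x" unfolding \<tau>_def by (rule someI_ex)
    then show "0 \<le> \<tau> x" "f (\<tau> x) = x" by auto
  qed
  define X where "X x h = (if x \<in> f ` {0..} then f (\<tau> x + h) else x)" for x h
  \<comment> \<open>Moving paths stay in the range and frozen points lie outside it, so paths of
    different kinds never meet.\<close>
  have range_invariant: "X x s \<in> f ` {0..} \<longleftrightarrow> x \<in> f ` {0..}" if "0 \<le> s" for x s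
    using that \<tau>(1)[of x] by (auto simp: X_def)
  have "deterministic_Markov_process X"
    unfolding deterministic_Markov_process_def
  proof (intro conjI allI impI)
    show "X x 0 = x" for x
      using \<tau> by (simp add: X_def)
    show "cadlag (X x)" for x
    proof (cases "x \<in> f ` {0..}")
      case True
      then have "X x = (\<lambda>h. f (\<tau> x + h))" by (auto simp: X_def)
      then show ?thesis using cadlag_shift[OF assms \<tau>(1)[OF True]] by simp
    next
      case False
      then have "X x = (\<lambda>h. x)" by (auto simp: X_def)
      then show ?thesis by (auto simp: cadlag_def intro: tendsto_const)
    qed
    fix x y s t h
    assume *: "0 \<le> s" "0 \<le> t" "X x s = X y t" "(0::real) \<le> h"
    show "X x (s + h) = X y (t + h)"
    proof (cases "x \<in> f ` {0..}")
      case True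
      then have y: "y \<in> f ` {0..}" using * range_invariant by metis
      have "f (\<tau> x + s + h) = f (\<tau> y + t + h)"
        by (rule future_determinedD[OF fd]) (use * True y \<tau> in \<open>auto simp: X_def\<close>)
      then show ?thesis using True y by (simp add: X_def add_ac)
    next
      case False
      then have y: "y \<notin> f ` {0..}" using * range_invariant by metis
      then show ?thesis using * False by (simp add: X_def)
    qed
  qed
  moreover have "X (f 0) t = f t" if "0 \<le> t" for t
  proof -
    have 0: "f 0 \<in> f ` {0..}" by simp
    have "f (\<tau> (f 0) + t) = f (0 + t)"
      by (rule future_determinedD[OF fd]) (use that \<tau>[OF 0] in auto)
    then show ?thesis by (simp add: X_def)
  qed
  ultimately show "Markov_expandable f"
    by (auto simp: Markov_expandable_def)
qed

section \<open>Bounds for the two infima\<close>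

lemma time0_le:
  assumes "0 \<le> s" "s < t" "f s = f t"
  shows "time0 f \<le> ereal s"
  unfolding time0_def by (rule Inf_lower) (use assms in auto)

lemma time1_le:
  assumes "0 \<le> s" "s < t" "f s = f t"
  shows "time1 f \<le> ereal t"
  unfolding time1_def by (rule Inf_lower) (use assms in auto)

lemma time0_ge:
  assumes "\<And>s t. 0 \<le> s \<Longrightarrow> s < t \<Longrightarrow> f s = f t \<Longrightarrow> c \<le> ereal s"
  shows "c \<le> time0 f"
  unfolding time0_def by (rule Inf_greatest) (use assms in auto)

lemma time1_ge:
  assumes "\<And>s t. 0 \<le> s \<Longrightarrow> s < t \<Longrightarrow> f s = f t \<Longrightarrow> c \<le> ereal t"
  shows "c \<le> time1 f"
  unfolding time1_def by (rule Inf_greatest) (use assms in auto)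

section \<open>Sufficiency of the three cases\<close>

lemma future_determined_if_inj_on:
  assumes "inj_on f {0..}"
  shows "future_determined f"
  by (rule future_determinedI) (use assms in \<open>force dest: inj_onD\<close>)

text \<open>If two times share a value, the earlier one is at least \<open>time0 f\<close>, so both
  futures run in the half-line where \<open>f\<close> is constant.\<close>

lemma future_determined_if_finally_constant:
  assumes "finally_constant f"
  shows "future_determined f"
proof (rule future_determinedI)
  fix s t h :: real assume *: "0 \<le> s" "s < t" "0 \<le> h" "f s = f t"
  then have "time0 f \<le> ereal s" by (intro time0_le)
  then have "time0 f \<le> ereal (s + h)" "time0 f \<le> ereal (t + h)"
    using * by (auto elim!: order_trans)
  then show "f (s + h) = f (t + h)"
    using assms unfolding finally_constant_def constant_on_def by auto
qed

lemma periodic_from_multiple: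
  fixes f :: "real \<Rightarrow> 'a"
  assumes "\<And>u. a \<le> u \<Longrightarrow> f (u + p) = f u" "0 \<le> p" "a \<le> u"
  shows "f (u + real n * p) = f u"
proof (induction n)
  case (Suc n)
  have "a \<le> u + real n * p" using assms(2,3) by (simp add: add_increasing2)
  from assms(1)[OF this] Suc show ?case by (simp add: algebra_simps)
qed simp

text \<open>Provides a representative modulo \<open>p\<close> in \<open>[a, a + p[\<close>; it
  serves to compare times of a periodic path and to find a multiple of a small period just beyond
  \<open>u\<close>.\<close>

lemma real_reduce_mod:
  fixes a p u :: real
  assumes "0 < p" "a \<le> u"
  obtains n v where "a \<le> v" "v < a + p" "u = v + real n * p"
proof
  define k where "k = nat \<lfloor>(u - a) / p\<rfloor>"
  have "0 \<le> \<lfloor>(u - a) / p\<rfloor>" using assms by simp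
  then have k: "real k = of_int \<lfloor>(u - a) / p\<rfloor>" by (simp add: k_def)
  have "real k \<le> (u - a) / p" "(u - a) / p < real k + 1"
    unfolding k by linarith+
  then show "a \<le> u - real k * p" "u - real k * p < a + p"
    using assms by (simp_all add: field_simps)
  show "u = u - real k * p + real k * p" by simp
qed

text \<open>On one period, from \<open>time0 f\<close> up to \<open>time1 f\<close>, the path is
  injective. Times with equal values therefore have the same representative modulo the period, and
  periodicity carries this over to their futures.\<close>

lemma future_determined_if_jump_periodic:
  assumes "jump_periodic f"
  shows "future_determined f"
proof -
  have lt: "time0 f < time1 f" using assms by (simp add: jump_periodic_def)
  have "0 \<le> time0 f" by (rule time0_ge) simp
  \<comment> \<open>Without repeated values \<open>time0 f\<close> would be infinite as well,
    contradicting \<open>lt\<close>.\<close>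
  moreover have "time1 f < \<infinity>"
  proof (rule ccontr)
    assume "\<not> time1 f < \<infinity>"
    then have "f s \<noteq> f t" if "0 \<le> s" "s < t" for s t
      using time1_le[OF that, of f] \<open>\<not> time1 f < \<infinity>\<close> by auto
    then have "\<infinity> \<le> time0 f" by (intro time0_ge) auto
    then show False using lt by simp
  qed
  ultimately obtain a b where ab: "time0 f = ereal a" "time1 f = ereal b"
    using lt by (cases "time0 f"; cases "time1 f") auto
  define p where "p = b - a"
  have p: "0 < p" and a: "0 \<le> a"
    using lt \<open>0 \<le> time0 f\<close> by (auto simp: p_def ab)
  have per: "f (u + p) = f u" if "a \<le> u" for u
    using assms that unfolding jump_periodic_def ab by (auto simp: p_def)
  \<comment> \<open>A coincidence here would be a repetition before \<open>b\<close>, the value of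
    \<open>time1 f\<close>.\<close>
  have inj: "v = w" if "a \<le> v" "v < a + p" "a \<le> w" "w < a + p" "f v = f w" for v w
    using time1_le[of v w f] time1_le[of w v f] that a
    by (cases v w rule: linorder_cases) (auto simp: ab p_def)
  show ?thesis
  proof (rule future_determinedI)
    fix s t h :: real assume *: "0 \<le> s" "s < t" "0 \<le> h" "f s = f t"
    then have "a \<le> s" "a \<le> t" using time0_le[of s t f] by (auto simp: ab)
    obtain m v where v: "a \<le> v" "v < a + p" "s = v + real m * p"
      using real_reduce_mod[OF p \<open>a \<le> s\<close>] .
    obtain n w where w: "a \<le> w" "w < a + p" "t = w + real n * p"
      using real_reduce_mod[OF p \<open>a \<le> t\<close>] .
    have mult: "f (u + real k * p) = f u" if "a \<le> u" for u k
      using periodic_from_multiple[of a f p] per p that by simp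
    have "v = w"
      using inj v w mult *(4) by metis
    moreover have "f (s + h) = f (v + h)" "f (t + h) = f (w + h)"
      using mult[of "v + h" m] mult[of "w + h" n] v w *(3) by (simp_all add: algebra_simps)
    ultimately show "f (s + h) = f (t + h)" by simp
  qed
qed

section \<open>Necessity of the three cases\<close>

lemma right_limit_eq:
  fixes f :: "real \<Rightarrow> 'a::t1_space"
  assumes "(f \<longlongrightarrow> f u) (at_right u)" "\<And>e. 0 < e \<Longrightarrow> \<exists>v. u < v \<and> v < u + e \<and> f v = c"
  shows "f u = c"
proof (rule ccontr)
  assume "f u \<noteq> c"
  \<comment> \<open>By right-continuity, \<open>f\<close> stays in \<open>U\<close> just after
    \<open>u\<close>, yet it takes the value \<open>c\<close> there.\<close>
  then obtain U where U: "open U" "f u \<in> U" "c \<notin> U" using t1_space by blast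
  then have "eventually (\<lambda>v. f v \<in> U) (at_right u)"
    using assms(1) by (simp add: tendsto_def)
  then obtain b where b: "u < b" "\<And>v. u < v \<Longrightarrow> v < b \<Longrightarrow> f v \<in> U"
    by (auto simp: eventually_at_right_field)
  obtain v where "u < v" "v < b" "f v = c" using assms(2)[of "b - u"] b(1) by auto
  then show False using b(2) U(3) by blast
qed

text \<open>The period \<open>q\<close> is valid from \<open>s\<close> on. Multiples of
  \<open>r\<close> move \<open>u\<close> beyond \<open>s\<close> without changing the values at
  \<open>u\<close> and \<open>u + q\<close>, so \<open>q\<close> also works at \<open>u\<close>,
  even if \<open>u < s\<close>.\<close>

lemma future_determined_period_transfer:
  assumes fd: "future_determined f"
    and s: "0 \<le> s" "0 < q" "f (s + q) = f s"
    and u: "0 \<le> u" "0 < r" "f (u + r) = f u"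
  shows "f (u + q) = f u"
proof -
  have per: "f (v + r) = f v" if "u \<le> v" for v
    using future_determinedD[OF fd, of "u + r" u "v - u"] u that by (simp add: algebra_simps)
  obtain n :: nat where "s - u < real n * r"
    using reals_Archimedean3[OF \<open>0 < r\<close>] by blast
  then have "f (u + real n * r + q) = f (u + real n * r)"
    using future_determinedD[OF fd, of "s + q" s "u + real n * r - s"] s
    by (simp add: algebra_simps)
  moreover have "f (v + real n * r) = f v" if "u \<le> v" for v
    using periodic_from_multiple[of u f r] per u that by simp
  from this[of "u + q"] this[of u]
  have "f (u + real n * r + q) = f (u + q)" "f (u + real n * r) = f u"
    using s by (simp_all add: algebra_simps)
  ultimately show ?thesis by simp
qed

text \<open>The infimum of the times whose value recurs is attained: one fixed \<open>q\<close> is a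
  period at every later time, and right-continuity extends this to the infimum.\<close>

lemma least_return_point:
  fixes f :: "real \<Rightarrow> 'a::t2_space"
  assumes fd: "future_determined f"
    and rc: "\<And>t. 0 \<le> t \<Longrightarrow> (f \<longlongrightarrow> f t) (at_right t)"
    and not_inj: "\<not> inj_on f {0..}"
  obtains a q where "0 \<le> a" "0 < q" "f (a + q) = f a"
    "\<And>s t. 0 \<le> s \<Longrightarrow> s < t \<Longrightarrow> f s = f t \<Longrightarrow> a \<le> s"
proof -
  define A where "A = {s. 0 \<le> s \<and> (\<exists>t>s. f s = f t)}"
  from not_inj obtain s0 t0 where s0: "0 \<le> s0" "s0 < t0" "f s0 = f t0"
    unfolding inj_on_def by (metis atLeast_iff linorder_less_linear)
  define q where "q = t0 - s0"
  have q: "0 < q" "f (s0 + q) = f s0" using s0 by (auto simp: q_def)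
  have A: "A \<noteq> {}" "bdd_below A" using s0 by (auto simp: A_def)
  define a where "a = Inf A"
  have a: "0 \<le> a" unfolding a_def using A(1) by (rule cInf_greatest) (simp add: A_def)
  have lower: "a \<le> s" if "s \<in> A" for s
    unfolding a_def using that A(2) by (rule cInf_lower)
  \<comment> \<open>Points of \<open>A\<close> below \<open>u\<close> come with their own return
    time \<open>t - s\<close>; transferring the fixed \<open>q\<close> makes the period independent
    of \<open>u\<close>, as the limit below requires.\<close>
  have per: "f (u + q) = f u" if u: "a < u" for u
  proof -
    obtain s where s: "s \<in> A" "s < u" using cInf_lessD[OF A(1)] u by (auto simp: a_def)
    then obtain t where t: "s < t" "f s = f t" "0 \<le> s" by (auto simp: A_def)
    have "f (u + (t - s)) = f u"
      using future_determinedD[OF fd, of s t "u - s"] s t by (simp add: algebra_simps)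
    then show ?thesis
      using future_determined_period_transfer[OF fd s0(1) q, of u "t - s"] t s by simp
  qed
  have "((\<lambda>u. f (u + q)) \<longlongrightarrow> f (a + q)) (at_right a)"
    using rc[of "a + q"] a q
    by (simp add: filterlim_at_right_to_0[of f _ "a + q"] filterlim_at_right_to_0[of _ _ a] add_ac)
  moreover have "eventually (\<lambda>u. f (u + q) = f u) (at_right a)"
    using per by (auto simp: eventually_at_right_field intro: exI[of _ "a + 1"])
  ultimately have "(f \<longlongrightarrow> f (a + q)) (at_right a)"
    using tendsto_cong by force
  then have "f (a + q) = f a"
    using rc[OF a] tendsto_unique trivial_limit_at_right_real by blast
  then show ?thesis
    using that[OF a q(1)] lower by (auto simp: A_def)
qed

lemma future_determined_imp_trichotomy:
  fixes f :: "real \<Rightarrow> 'a::t2_space"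
  assumes fd: "future_determined f"
    and rc: "\<And>t. 0 \<le> t \<Longrightarrow> (f \<longlongrightarrow> f t) (at_right t)"
  shows "inj_on f {0..} \<or> finally_constant f \<or> jump_periodic f"
proof (cases "inj_on f {0..}")
  case False
  from least_return_point[OF fd rc this] obtain a q0
    where a: "0 \<le> a" and q0: "0 < q0" "f (a + q0) = f a"
      and least: "\<And>s t. 0 \<le> s \<Longrightarrow> s < t \<Longrightarrow> f s = f t \<Longrightarrow> a \<le> s"
    by blast
  define D where "D = {q. 0 < q \<and> f (a + q) = f a}"
  have time0: "time0 f = ereal a"
  proof (rule antisym)
    show "time0 f \<le> ereal a" by (rule time0_le[of a "a + q0"]) (use a q0 in auto)
    show "ereal a \<le> time0 f" by (rule time0_ge) (use least in auto)
  qed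
  have per: "f (u + q) = f u" if "q \<in> D" "a \<le> u" for u q
    using future_determinedD[OF fd, of "a + q" a "u - a"] that a
    by (simp add: D_def algebra_simps)
  have return_time: "t - s \<in> D" if "0 \<le> s" "s < t" "f s = f t" for s t
    using future_determined_period_transfer[OF fd, of s "t - s" a q0] that a q0
    by (simp add: D_def)
  \<comment> \<open>Both \<open>a + p\<close> and \<open>a + q\<close> carry the value
    \<open>f a\<close>, so their distance is a return time.\<close>
  have D_diff: "q - p \<in> D" if "p \<in> D" "q \<in> D" "p < q" for p q
    using that a by (intro return_time[of "a + p" "a + q", simplified]) (auto simp: D_def)
  show ?thesis
  proof (cases "\<forall>e>0. \<exists>q\<in>D. q < e")
    case True
    have const: "f u = f a" if u: "a \<le> u" for u
    proof (rule right_limit_eq)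
      show "(f \<longlongrightarrow> f u) (at_right u)" using rc a u by simp
      fix e :: real assume "0 < e"
      then obtain q where q: "q \<in> D" "q < e" using True by blast
      then have "0 < q" by (simp add: D_def)
      obtain n v where v: "a \<le> v" "v < a + q" "u = v + real n * q"
        using real_reduce_mod[OF \<open>0 < q\<close> u] .
      \<comment> \<open>The successor of \<open>n\<close> gives a point strictly to the right of
        \<open>u\<close>, at distance at most \<open>q < e\<close>.\<close>
      have "f (a + real (Suc n) * q) = f a"
        using periodic_from_multiple[of a f q a "Suc n"] per q \<open>0 < q\<close> by simp
      moreover have "u < a + real (Suc n) * q" "a + real (Suc n) * q < u + e"
        using v q by (auto simp: algebra_simps)
      ultimately show "\<exists>v. u < v \<and> v < u + e \<and> f v = f a" by blast
    qed
    have "time1 f = ereal a"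
    proof (rule antisym)
      show "time1 f \<le> ereal a"
      \<comment> \<open>The infimum is not attained, since \<open>a \<le> s < t\<close> for every
        repetition; but each \<open>a + e\<close> repeats the value at \<open>a\<close>.\<close>
      proof (rule ereal_le_epsilon2)
        fix e :: real assume "0 < e"
        then show "time1 f \<le> ereal a + ereal e"
          using time1_le[of a "a + e" f] const[of "a + e"] a by simp
      qed
      show "ereal a \<le> time1 f"
      proof (rule time1_ge)
        fix s t :: real assume "0 \<le> s" "s < t" "f s = f t"
        then show "ereal a \<le> ereal t" using least[of s t] by simp
      qed
    qed
    moreover have "inj_on f {t. 0 \<le> t \<and> t < a}"
    proof (rule inj_onI)
      fix s t assume "s \<in> {t. 0 \<le> t \<and> t < a}" "t \<in> {t. 0 \<le> t \<and> t < a}" "f s = f t"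
      then show "s = t"
        using least[of s t] least[of t s] by (cases s t rule: linorder_cases) auto
    qed
    moreover have "f constant_on {t. a \<le> t}"
      unfolding constant_on_def using const by blast
    ultimately have "finally_constant f"
      by (simp add: finally_constant_def time0)
    then show ?thesis by simp
  next
    case False
    then obtain e where e: "0 < e" "\<And>q. q \<in> D \<Longrightarrow> e \<le> q" by force
    define p where "p = Inf D"
    have D: "D \<noteq> {}" "bdd_below D" using q0 by (auto simp: D_def intro: bdd_belowI[of _ 0])
    have "e \<le> p" unfolding p_def using D(1) e(2) by (rule cInf_greatest)
    with e have "0 < p" by simp
    have lower: "p \<le> q" if "q \<in> D" for q
      unfolding p_def using that D(2) by (rule cInf_lower)
    have "p \<in> D"
    proof (rule ccontr)
      assume "p \<notin> D"
      \<comment> \<open>If \<open>p\<close> were not attained, \<open>D\<close> would contain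
        \<open>r < q\<close> in \<open>[p, 2 * p[\<close>; their difference would be an element of
        \<open>D\<close> below \<open>p\<close>.\<close>
      obtain q where q: "q \<in> D" "q < 2 * p"
        using cInf_lessD[OF D(1), of "2 * p"] \<open>0 < p\<close> by (auto simp: p_def)
      with \<open>p \<notin> D\<close> lower have "p < q" by (metis order_le_less)
      then obtain r where r: "r \<in> D" "r < q"
        using cInf_lessD[OF D(1), of q] by (auto simp: p_def)
      then have "p \<le> q - r" "p \<le> r" using lower D_diff q by auto
      then show False using q by simp
    qed
    have "time1 f = ereal (a + p)"
    proof (rule antisym)
      show "time1 f \<le> ereal (a + p)"
        by (rule time1_le[of a]) (use a \<open>0 < p\<close> \<open>p \<in> D\<close> in \<open>auto simp: D_def\<close>)
      show "ereal (a + p) \<le> time1 f"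
      proof (rule time1_ge)
        fix s t :: real assume "0 \<le> s" "s < t" "f s = f t"
        then show "ereal (a + p) \<le> ereal t" using least[of s t] lower[OF return_time[of s t]] by simp
      qed
    qed
    moreover have "f u = f (u - p)" if "a + p \<le> u" for u
      using per[OF \<open>p \<in> D\<close>, of "u - p"] that by simp
    ultimately have "jump_periodic f"
      using \<open>0 < p\<close> by (simp add: jump_periodic_def time0)
    then show ?thesis by simp
  qed
qed simp

theorem theorem2p4:
  fixes f :: "real \<Rightarrow> real ^ 'd"
  assumes "cadlag f"
  shows "Markov_expandable f \<longleftrightarrow>
           inj_on f {0..} \<or> finally_constant f \<or> jump_periodic f"
proof -
  have "(f \<longlongrightarrow> f t) (at_right t)" if "0 \<le> t" for t
    using assms that by (simp add: cadlag_def)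
  then have "inj_on f {0..} \<or> finally_constant f \<or> jump_periodic f" if "future_determined f"
    using future_determined_imp_trichotomy[OF that] by blast
  then show ?thesis
    unfolding Markov_expandable_iff_future_determined[OF assms]
    using future_determined_if_inj_on future_determined_if_finally_constant
      future_determined_if_jump_periodic by blast
qed

end
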